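(* Let $p$ be a prime, $M=M[A]$ a simple, coloopless, 3-connected $p$-matroid on ground set $E$ with $|E|>4$, $a,b\in E$ distinct, $\alpha\in GF(p)$ nonzero, $e\in\{a,b\}$. Then the $es$-splitting matroid $M^e_{a,b}$ is 3-connected.
   Context: A $p$-matroid is a matroid representable over $GF(p)$, $A$ a representing matrix over $GF(p)$ with columns indexed by $E$. $A'_{a,b}$ is obtained from $A$ by appending a last row with $\alpha$ in columns $a,b$ and $0$ elsewhere, then a column $z$ with last coordinate $\alpha$ and $0$ elsewhere. $A^e_{a,b}$ is obtained from $A'_{a,b}$ by appending a column $\gamma$ = (column of $e$) $-$ (column $z$); $M^e_{a,b}$ is the vector matroid of $A^e_{a,b}$ on $E\cup\{z,\gamma\}$. A $k$-separation of a matroid $N$ with rank function $r$ is a partition $\{S,T\}$ of its ground set with $|S|,|T|\ge k$ and $r(S)+r(T)-r(N)<k$; $N$ is 3-connected if it has no $1$- or $2$-separation. *)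

theory Defs
  imports "HOL-Analysis.Analysis" "Berlekamp_Zassenhaus.Finite_Field"
begin

record 'e matroid =
  ground :: "'e set"
  indep :: "'e set \<Rightarrow> bool"

definition is_matroid :: "'e matroid \<Rightarrow> bool" where
  "is_matroid M \<longleftrightarrow>
     finite (ground M) \<and>
     (\<forall>X. indep M X \<longrightarrow> X \<subseteq> ground M) \<and>
     indep M {} \<and>
     (\<forall>X Y. indep M X \<and> Y \<subseteq> X \<longrightarrow> indep M Y) \<and>
     (\<forall>X Y. indep M X \<and> indep M Y \<and> card X < card Y \<longrightarrow>
        (\<exists>y\<in>Y - X. indep M (insert y X)))"

definition rank_of :: "'e matroid \<Rightarrow> 'e set \<Rightarrow> nat" where
  "rank_of M S = Max {card I | I. I \<subseteq> S \<and> indep M I}"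

definition basis_of :: "'e matroid \<Rightarrow> 'e set \<Rightarrow> bool" where
  "basis_of M B \<longleftrightarrow> indep M B \<and> (\<forall>I. indep M I \<and> B \<subseteq> I \<longrightarrow> I = B)"

definition circuit :: "'e matroid \<Rightarrow> 'e set \<Rightarrow> bool" where
  "circuit M C \<longleftrightarrow> C \<subseteq> ground M \<and> \<not> indep M C \<and> (\<forall>D. D \<subset> C \<longrightarrow> indep M D)"

definition loop :: "'e matroid \<Rightarrow> 'e \<Rightarrow> bool" where
  "loop M x \<longleftrightarrow> circuit M {x}"

definition parallel :: "'e matroid \<Rightarrow> 'e \<Rightarrow> 'e \<Rightarrow> bool" where
  "parallel M x y \<longleftrightarrow> x \<noteq> y \<and> circuit M {x, y}"

definition simple_matroid :: "'e matroid \<Rightarrow> bool" where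
  "simple_matroid M \<longleftrightarrow> (\<nexists>x. loop M x) \<and> (\<nexists>x y. parallel M x y)"

definition coloop :: "'e matroid \<Rightarrow> 'e \<Rightarrow> bool" where
  "coloop M x \<longleftrightarrow> x \<in> ground M \<and> (\<forall>B. basis_of M B \<longrightarrow> x \<in> B)"

definition coloopless :: "'e matroid \<Rightarrow> bool" where
  "coloopless M \<longleftrightarrow> (\<nexists>x. coloop M x)"

definition k_separation :: "nat \<Rightarrow> 'e matroid \<Rightarrow> 'e set \<Rightarrow> 'e set \<Rightarrow> bool" where
  "k_separation k M S T \<longleftrightarrow>
     S \<union> T = ground M \<and> S \<inter> T = {} \<and> card S \<ge> k \<and> card T \<ge> k \<and>
     int (rank_of M S) + int (rank_of M T) - int (rank_of M (ground M)) < int k"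

definition three_connected :: "'e matroid \<Rightarrow> bool" where
  "three_connected M \<longleftrightarrow>
     (\<nexists>S T. k_separation 1 M S T) \<and> (\<nexists>S T. k_separation 2 M S T)"

text \<open>
  The ground set is the type of column labels. A set of labels is independent if the
  corresponding columns, as an indexed family, are linearly independent; hence the injectivity
  condition, which makes labels of equal columns dependent.
\<close>

definition vector_matroid :: "'k::field ^ 'e ^ 'r \<Rightarrow> 'e matroid" where
  "vector_matroid A =
     \<lparr> ground = UNIV,
       indep = (\<lambda>S. inj_on (\<lambda>j. column j A) S \<and> vec.independent ((\<lambda>j. column j A) ` S)) \<rparr>"

text \<open>An appended row or column gets the new label \<open>None\<close>; an old label \<open>x\<close> becomes \<open>Some x\<close>.\<close>

definition append_row :: "'k ^ 'n ^ 'm \<Rightarrow> 'k ^ 'n \<Rightarrow> 'k ^ 'n ^ ('m option)" where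
  "append_row A v = (\<chi> i. case i of None \<Rightarrow> v | Some i' \<Rightarrow> A $ i')"

definition append_col :: "'k ^ 'n ^ 'm \<Rightarrow> 'k ^ 'm \<Rightarrow> 'k ^ ('n option) ^ 'm" where
  "append_col A v = (\<chi> i j. case j of None \<Rightarrow> v $ i | Some j' \<Rightarrow> A $ i $ j')"

text \<open>The matrix $A'_{a,b}$: its column \<open>None\<close> is $z$.\<close>

definition splitting_matrix ::
    "'k::field ^ 'e ^ 'r \<Rightarrow> 'e \<Rightarrow> 'e \<Rightarrow> 'k \<Rightarrow> 'k ^ ('e option) ^ ('r option)" where
  "splitting_matrix A a b \<alpha> =
     append_col (append_row A (\<chi> j. if j = a \<or> j = b then \<alpha> else 0))
       (\<chi> i. if i = None then \<alpha> else 0)"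

text \<open>
  The matrix $A^e_{a,b}$: its column \<open>None\<close> is $\gamma$, its column \<open>Some None\<close> is $z$, and
  \<open>Some (Some x)\<close> is the column of the original element \<open>x\<close>.
\<close>

definition es_splitting_matrix ::
    "'k::field ^ 'e ^ 'r \<Rightarrow> 'e \<Rightarrow> 'e \<Rightarrow> 'e \<Rightarrow> 'k \<Rightarrow> 'k ^ ('e option option) ^ ('r option)" where
  "es_splitting_matrix A a b e \<alpha> =
     (let A' = splitting_matrix A a b \<alpha>
      in append_col A' (column (Some e) A' - column None A'))"

definition es_splitting ::
    "'k::field ^ 'e ^ 'r \<Rightarrow> 'e \<Rightarrow> 'e \<Rightarrow> 'e \<Rightarrow> 'k \<Rightarrow> 'e option option matroid" where
  "es_splitting A a b e \<alpha> = vector_matroid (es_splitting_matrix A a b e \<alpha>)"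

lemma is_matroid_vector_matroid: "is_matroid (vector_matroid A)"
proof -
  let ?c = "\<lambda>j. column j A"
  have aug: "\<exists>y\<in>Y - X. inj_on ?c (insert y X) \<and> vec.independent (?c ` insert y X)"
    if X: "inj_on ?c X" "vec.independent (?c ` X)"
      and Y: "inj_on ?c Y" "vec.independent (?c ` Y)"
      and less: "card X < card Y" for X Y
  proof -
    have "\<not> ?c ` Y \<subseteq> vec.span (?c ` X)"
    proof
      assume "?c ` Y \<subseteq> vec.span (?c ` X)"
      then have "card (?c ` Y) \<le> card (?c ` X)"
        using vec.independent_span_bound[of "?c ` X" "?c ` Y"] Y(2) by simp
      then show False using X(1) Y(1) less by (simp add: card_image)
    qed
    then obtain y where y: "y \<in> Y" "?c y \<notin> vec.span (?c ` X)" by blast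
    have "?c y \<notin> ?c ` X"
      using y(2) by (rule contrapos_nn) (rule vec.span_base)
    then have "inj_on ?c (insert y X)" and "y \<notin> X"
      using X(1) by (simp_all add: inj_on_insert inj_on_diff imageI) auto
    moreover have "vec.independent (?c ` insert y X)"
      unfolding image_insert using y(2) X(2) by (rule vec.independent_insertI)
    ultimately show ?thesis
      using y(1) by (intro bexI[of _ y] conjI DiffI)
  qed
  have sub: "inj_on ?c Y \<and> vec.independent (?c ` Y)"
    if X: "inj_on ?c X \<and> vec.independent (?c ` X)" and "Y \<subseteq> X" for X Y
    using inj_on_subset[OF conjunct1[OF X] \<open>Y \<subseteq> X\<close>]
      vec.independent_mono[OF conjunct2[OF X] image_mono[OF \<open>Y \<subseteq> X\<close>]] by (rule conjI)
  have emp: "inj_on ?c {} \<and> vec.independent (?c ` {})"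
    by (simp add: vec.independent_empty)
  show ?thesis
    unfolding is_matroid_def vector_matroid_def matroid.simps
  proof (intro conjI allI impI)
    fix X Y assume "(inj_on ?c X \<and> vec.independent (?c ` X)) \<and> Y \<subseteq> X"
    then show "inj_on ?c Y" "vec.independent (?c ` Y)"
      using sub[of X Y] by simp_all
  next
    fix X Y
    assume "(inj_on ?c X \<and> vec.independent (?c ` X)) \<and>
      (inj_on ?c Y \<and> vec.independent (?c ` Y)) \<and> card X < card Y"
    then show "\<exists>y\<in>Y - X. inj_on ?c (insert y X) \<and> vec.independent (?c ` insert y X)"
      by (intro aug) simp_all
  qed (use emp in simp_all)
qed

end

theory Submission
  imports Defs
begin

text \<open>
  Deleting the last coordinate maps the columns of $A^e_{a,b}$ onto those of $A$, sending
  $\gamma$ to $e$ and $z$ to $0$. Hence a set of columns has rank at least that of its image, and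
  exactly one more as soon as its span contains $z$. For a partition $\{S,T\}$ with $z \in T$ this
  bounds $r(S)+r(T)-r(N)$ below by the connectivity of the induced partition of $E$, which is at
  least $2$ unless $S$ or $T$ contains at most one element of $E$. In these remaining cases either
  the images of $S$ and $T$ overlap in $e$, which gains one, or $z$ is also spanned by $S$: if $S$
  contains $e$ and $\gamma$, then $z = e - \gamma$, and if $S$ contains $E - e$, then it spans $z$
  because deleting $\{a,b\}$ does not lower the rank of $M$.
\<close>

section \<open>Rank in a vector matroid\<close>

lemma ground_vector_matroid [simp]: "ground (vector_matroid A) = UNIV"
  by (simp add: vector_matroid_def)

text \<open>An independent index set has as many elements as its column set, which bounds its size
  by the dimension. Conversely, a basis chosen among the columns lifts to indices by picking one
  label per vector.\<close>

lemma rank_of_vector_matroid: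
  fixes A :: "'k::field ^ 'e::finite ^ 'r::finite"
  shows "rank_of (vector_matroid A) S = vec.dim ((\<lambda>j. column j A) ` S)"
proof -
  let ?c = "\<lambda>j. column j A"
  let ?K = "{card I | I. I \<subseteq> S \<and> indep (vector_matroid A) I}"
  have indep: "indep (vector_matroid A) I \<longleftrightarrow> inj_on ?c I \<and> vec.independent (?c ` I)" for I
    by (simp add: vector_matroid_def)
  have "finite ?K" by simp
  moreover have "n \<le> vec.dim (?c ` S)" if "n \<in> ?K" for n
  proof -
    from that obtain I where I: "n = card I" "I \<subseteq> S" "inj_on ?c I" "vec.independent (?c ` I)"
      using indep by blast
    then show ?thesis
      using vec.independent_card_le_dim[of "?c ` I" "?c ` S"] by (simp add: image_mono card_image)
  qed
  moreover have "vec.dim (?c ` S) \<in> ?K"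
  proof -
    obtain B where B: "B \<subseteq> ?c ` S" "vec.independent B" "card B = vec.dim (?c ` S)"
      using vec.basis_exists[of "?c ` S"] by metis
    obtain I where I: "I \<subseteq> S" "inj_on ?c I" "B = ?c ` I"
      using B(1) by (meson subset_image_inj)
    then show ?thesis using B indep by (auto simp: card_image intro!: exI[of _ I])
  qed
  ultimately show ?thesis unfolding rank_of_def by (intro Max_eqI) auto
qed

lemma rank_of_vector_matroid_mono:
  fixes A :: "'k::field ^ 'e::finite ^ 'r::finite"
  assumes "S \<subseteq> T"
  shows "rank_of (vector_matroid A) S \<le> rank_of (vector_matroid A) T"
  unfolding rank_of_vector_matroid using assms by (intro vec.dim_subset image_mono)

lemma rank_of_vector_matroid_le_card:
  fixes A :: "'k::field ^ 'e::finite ^ 'r::finite"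
  shows "rank_of (vector_matroid A) S \<le> card S"
  unfolding rank_of_vector_matroid
  using vec.dim_le_card'[of "(\<lambda>j. column j A) ` S"] card_image_le[of S "\<lambda>j. column j A"] by simp

text \<open>The sides of a separation are complementary, so one set \<open>S\<close> describes it,
  and moving the subtracted rank to the other side keeps the inequality in the naturals.\<close>

lemma three_connected_vector_matroid_iff:
  fixes A :: "'k::field ^ 'e::finite ^ 'r::finite"
  shows "three_connected (vector_matroid A) \<longleftrightarrow>
    (\<forall>S. \<forall>k\<in>{1, 2}. k \<le> card S \<longrightarrow> k \<le> card (- S) \<longrightarrow>
      rank_of (vector_matroid A) UNIV + k
        \<le> rank_of (vector_matroid A) S + rank_of (vector_matroid A) (- S))"
proof -
  have "S \<union> T = UNIV \<and> S \<inter> T = {} \<longleftrightarrow> T = - S" for S T :: "'e set" by auto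
  then have "(\<nexists>S T. k_separation k (vector_matroid A) S T) \<longleftrightarrow>
    (\<forall>S. k \<le> card S \<longrightarrow> k \<le> card (- S) \<longrightarrow>
      rank_of (vector_matroid A) UNIV + k
        \<le> rank_of (vector_matroid A) S + rank_of (vector_matroid A) (- S))" for k
    unfolding k_separation_def ground_vector_matroid by (smt (verit) of_nat_add of_nat_le_iff)
  then show ?thesis unfolding three_connected_def by auto
qed

section \<open>Vectors with an additional coordinate\<close>

text \<open>The coordinate \<open>None\<close> is the appended last row, so z is
  \<open>extend_vec 0 \<alpha>\<close>.\<close>

definition extend_vec :: "'k ^ 'r \<Rightarrow> 'k \<Rightarrow> 'k ^ 'r option" where
  "extend_vec v t = (\<chi> i. case i of None \<Rightarrow> t | Some i' \<Rightarrow> v $ i')"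

definition restrict_vec :: "'k ^ 'r option \<Rightarrow> 'k ^ 'r" where
  "restrict_vec w = (\<chi> i. w $ Some i)"

lemma extend_vec_nth [simp]:
  "extend_vec v t $ None = t" "extend_vec v t $ Some i = v $ i"
  by (simp_all add: extend_vec_def)

lemma restrict_extend_vec [simp]: "restrict_vec (extend_vec v t) = v"
  by (simp add: restrict_vec_def vec_eq_iff)

lemma vec_option_eq_iff: "v = w \<longleftrightarrow> v $ None = w $ None \<and> (\<forall>i. v $ Some i = w $ Some i)"
  by (metis option.exhaust vec_eq_iff)

lemma linear_restrict_vec:
  "Vector_Spaces.linear (*s) (*s) (restrict_vec :: 'k::field ^ 'r option \<Rightarrow> 'k ^ 'r)"
  by unfold_locales (simp_all add: restrict_vec_def vec_eq_iff algebra_simps)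

lemma linear_extend_vec_0:
  "Vector_Spaces.linear (*s) (*s) (\<lambda>v :: 'k::field ^ 'r. extend_vec v 0)"
  by unfold_locales (simp_all add: vec_option_eq_iff algebra_simps)

lemma dim_restrict_vec_le:
  fixes X :: "('k::field ^ 'r::finite option) set"
  shows "vec.dim (restrict_vec ` X) \<le> vec.dim X"
  by (rule vec.dim_image_le[OF linear_restrict_vec])

text \<open>The vector z spans the kernel of \<open>restrict_vec\<close>. Once z is spanned, the
  last coordinate of every member of \<open>X\<close> can be cleared, so \<open>X\<close> spans the
  same space as z together with the restrictions padded by 0.\<close>

lemma dim_eq_Suc_dim_restrict_vec:
  fixes X :: "('k::field ^ 'r::finite option) set"
  assumes "\<alpha> \<noteq> 0" and z: "extend_vec 0 \<alpha> \<in> vec.span X"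
  shows "vec.dim X = Suc (vec.dim (restrict_vec ` X))"
proof -
  let ?z = "extend_vec 0 \<alpha> :: 'k ^ 'r option"
  let ?W = "(\<lambda>v. extend_vec v 0) ` restrict_vec ` X"
  have decomp: "w = extend_vec (restrict_vec w) 0 + (w $ None / \<alpha>) *s ?z" for w
    using \<open>\<alpha> \<noteq> 0\<close> by (simp add: vec_option_eq_iff restrict_vec_def)
  have "extend_vec (restrict_vec w) 0 \<in> vec.span X" if "w \<in> X" for w
    using vec.span_diff[OF vec.span_base[OF that] vec.span_scale[OF z, of "w $ None / \<alpha>"]]
      decomp[of w] by (metis add_diff_cancel_right')
  then have "insert ?z ?W \<subseteq> vec.span X" using z by auto
  moreover have "X \<subseteq> vec.span (insert ?z ?W)"
  proof
    fix w assume "w \<in> X"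
    then have "extend_vec (restrict_vec w) 0 \<in> vec.span (insert ?z ?W)"
      by (intro vec.span_base) auto
    moreover have "(w $ None / \<alpha>) *s ?z \<in> vec.span (insert ?z ?W)"
      by (intro vec.span_scale vec.span_base) simp
    ultimately show "w \<in> vec.span (insert ?z ?W)"
      using decomp[of w] vec.span_add by metis
  qed
  ultimately have "vec.dim X = vec.dim (insert ?z ?W)"
    by (intro antisym vec.dim_mono)
  moreover have "?z \<notin> vec.span ?W"
  proof
    assume "?z \<in> vec.span ?W"
    moreover have "vec.subspace {w :: 'k ^ 'r option. w $ None = 0}"
      by (simp add: vec.subspace_def)
    then have "vec.span ?W \<subseteq> {w. w $ None = 0}"
      by (intro vec.span_minimal) auto
    ultimately show False using \<open>\<alpha> \<noteq> 0\<close> by auto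
  qed
  \<comment> \<open>Padding and restricting are linear, and restricting undoes padding, so neither
    loses dimension here.\<close>
  moreover have "vec.dim ?W = vec.dim (restrict_vec ` X)"
    using vec.dim_image_le[OF linear_extend_vec_0, of "restrict_vec ` X"]
      dim_restrict_vec_le[of ?W] by (simp add: image_image)
  ultimately show ?thesis by (simp add: vec.dim_insert)
qed

section \<open>The columns of the es-splitting matrix\<close>

text \<open>The last entry of gamma is \<alpha> - \<alpha> = 0 exactly because e is one of the split
  elements.\<close>

lemma column_es_splitting_matrix:
  "column (Some (Some x)) (es_splitting_matrix A a b e \<alpha>) =
     extend_vec (column x A) (if x \<in> {a, b} then \<alpha> else 0)"
  "column (Some None) (es_splitting_matrix A a b e \<alpha>) = extend_vec 0 \<alpha>"
  "e \<in> {a, b} \<Longrightarrow> column None (es_splitting_matrix A a b e \<alpha>) = extend_vec (column e A) 0"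
  by (auto simp: vec_option_eq_iff column_def es_splitting_matrix_def splitting_matrix_def
      append_col_def append_row_def)

text \<open>This is the trace of \<open>S\<close> on E after the last coordinate is deleted: gamma
  becomes a copy of e, and z, which becomes 0, disappears.\<close>

definition merge_gamma :: "'e \<Rightarrow> 'e option option set \<Rightarrow> 'e set" where
  "merge_gamma e S = {x. Some (Some x) \<in> S \<or> x = e \<and> None \<in> S}"

lemma dim_restrict_vec_columns:
  fixes A :: "'k::field ^ 'e::finite ^ 'r::finite"
  assumes "e \<in> {a, b}"
  shows "vec.dim (restrict_vec ` (\<lambda>j. column j (es_splitting_matrix A a b e \<alpha>)) ` S) =
    rank_of (vector_matroid A) (merge_gamma e S)"
proof -
  let ?d = "\<lambda>j. column j (es_splitting_matrix A a b e \<alpha>)"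
  let ?X = "restrict_vec ` ?d ` S" and ?Y = "(\<lambda>j. column j A) ` merge_gamma e S"
  note col = column_es_splitting_matrix column_es_splitting_matrix(3)[OF assms]
  have "restrict_vec (?d j) \<in> insert 0 ?Y" if "j \<in> S" for j
  proof (cases j)
    case None
    then show ?thesis using that assms by (simp add: col merge_gamma_def)
  next
    case (Some i)
    then show ?thesis using that by (cases i) (auto simp: col merge_gamma_def)
  qed
  then have "?X \<subseteq> insert 0 ?Y" by blast
  then have "?X \<subseteq> vec.span ?Y"
    using vec.span_superset[of "insert 0 ?Y"] unfolding vec.span_insert_0 by (rule subset_trans)
  moreover have "?Y \<subseteq> ?X"
  proof
    fix v assume "v \<in> ?Y"
    then obtain x where x: "v = column x A" "Some (Some x) \<in> S \<or> x = e \<and> None \<in> S"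
      by (auto simp: merge_gamma_def)
    have "v = restrict_vec (?d (Some (Some x)))" by (simp add: x col)
    moreover have "v = restrict_vec (?d None)" if "x = e" using that x assms by (simp add: col)
    ultimately show "v \<in> ?X" using x(2) by blast
  qed
  ultimately show ?thesis
    unfolding rank_of_vector_matroid by (intro antisym vec.dim_mono vec.dim_subset)
qed

lemma rank_of_es_splitting_ge:
  fixes A :: "'k::field ^ 'e::finite ^ 'r::finite"
  assumes "e \<in> {a, b}"
  shows "rank_of (vector_matroid A) (merge_gamma e S) \<le> rank_of (es_splitting A a b e \<alpha>) S"
  unfolding es_splitting_def rank_of_vector_matroid[of "es_splitting_matrix A a b e \<alpha>"]
  using dim_restrict_vec_le dim_restrict_vec_columns[OF assms] by metis

lemma rank_of_es_splitting_eq: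
  fixes A :: "'k::field ^ 'e::finite ^ 'r::finite"
  assumes "e \<in> {a, b}" "\<alpha> \<noteq> 0"
    and "extend_vec 0 \<alpha> \<in> vec.span ((\<lambda>j. column j (es_splitting_matrix A a b e \<alpha>)) ` S)"
  shows "rank_of (es_splitting A a b e \<alpha>) S = Suc (rank_of (vector_matroid A) (merge_gamma e S))"
  unfolding es_splitting_def rank_of_vector_matroid[of "es_splitting_matrix A a b e \<alpha>"]
  using dim_eq_Suc_dim_restrict_vec[OF assms(2,3)] dim_restrict_vec_columns[OF assms(1)] by metis

section \<open>Three-connectedness\<close>

theorem three_connected_es_splitting:
  fixes A :: "'k::field ^ 'e::finite ^ 'r::finite"
  assumes conn: "three_connected (vector_matroid A)" and card: "CARD('e) \<ge> 4"
    and "a \<noteq> b" and \<alpha>: "\<alpha> \<noteq> 0" and e: "e \<in> {a, b}"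
  shows "three_connected (es_splitting A a b e \<alpha>)"
proof -
  define r where "r = rank_of (vector_matroid A)"
  define s where "s = rank_of (es_splitting A a b e \<alpha>)"
  define d where "d j = column j (es_splitting_matrix A a b e \<alpha>)" for j
  let ?z = "extend_vec 0 \<alpha> :: 'k ^ 'r option"
  note col = column_es_splitting_matrix[where A = A and a = a and b = b and e = e and \<alpha> = \<alpha>, folded d_def]
  have sep: "r UNIV + k \<le> r S + r (- S)"
    if "k \<in> {1, 2}" "k \<le> card S" "k \<le> card (- S)" for S k
    using conn that unfolding three_connected_vector_matroid_iff r_def by blast
  have mono: "r S \<le> r T" if "S \<subseteq> T" for S T
    using rank_of_vector_matroid_mono[OF that] by (simp add: r_def)
  have le_card: "r S \<le> card S" for S
    using rank_of_vector_matroid_le_card by (simp add: r_def)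
  have card_compl: "card (- S) = CARD('e) - card S" for S :: "'e set"
    by (simp add: Compl_eq_Diff_UNIV card_Diff_subset)
  have r1: "1 \<le> r {x}" and r_compl1: "r UNIV \<le> r (- {x})" for x
  proof -
    have "r UNIV + 1 \<le> r {x} + r (- {x})" using card by (intro sep) (auto simp: card_compl)
    then show "1 \<le> r {x}" "r UNIV \<le> r (- {x})"
      using le_card[of "{x}"] mono[of "- {x}" UNIV] by simp_all
  qed
  \<comment> \<open>With at least four elements, a pair and its complement are both large enough to
    be tested for a 2-separation. The trivial upper bound on either rank then forces the lower bound
    on the other.\<close>
  have r2: "2 \<le> r {x, y}" and r_compl2: "r UNIV \<le> r (- {x, y})" if "x \<noteq> y" for x y
  proof -
    have "r UNIV + 2 \<le> r {x, y} + r (- {x, y})"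
      using card that by (intro sep) (auto simp: card_compl)
    then show "2 \<le> r {x, y}" "r UNIV \<le> r (- {x, y})"
      using le_card[of "{x, y}"] mono[of "- {x, y}" UNIV] that by simp_all
  qed
  have s_ge: "r (merge_gamma e S) \<le> s S" for S
    unfolding r_def s_def by (rule rank_of_es_splitting_ge[OF e])
  have s_eq: "s S = Suc (r (merge_gamma e S))" if "?z \<in> vec.span (d ` S)" for S
    unfolding r_def s_def using that by (intro rank_of_es_splitting_eq[OF e \<alpha>]) (simp add: d_def)
  have z_in: "?z \<in> vec.span (d ` S)" if "Some None \<in> S" for S
    using that by (intro vec.span_base) (auto simp: col image_iff intro!: bexI[of _ "Some None"])
  have z_diff: "?z \<in> vec.span (d ` S)" if "Some (Some e) \<in> S" "None \<in> S" for S
  proof -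
    have "d (Some (Some e)) - d None \<in> vec.span (d ` S)"
      using that by (intro vec.span_diff vec.span_base) auto
    moreover have "d (Some (Some e)) - d None = ?z"
      using e by (simp add: col vec_option_eq_iff)
    ultimately show ?thesis by simp
  qed
  obtain f where f: "{a, b} = {e, f}" "e \<noteq> f" using e \<open>a \<noteq> b\<close> by auto
  \<comment> \<open>In A, column f is a combination of the columns outside {e, f}. Those columns
    receive last entry 0, so the same combination yields f padded by 0, which differs from the new
    column f by z.\<close>
  have z_compl: "?z \<in> vec.span (d ` S)" if "\<And>x. x \<noteq> e \<Longrightarrow> Some (Some x) \<in> S" for S
  proof -
    let ?U = "(\<lambda>j. column j A) ` (- {e, f})"
    have "vec.span ?U = vec.span (range (\<lambda>j. column j A))"
      using r_compl2[OF f(2)] unfolding r_def rank_of_vector_matroid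
      by (intro vec.dim_eq_span image_mono) auto
    then have "column f A \<in> vec.span ?U"
      by (simp add: vec.span_base)
    then have "extend_vec (column f A) 0 \<in> vec.span ((\<lambda>v. extend_vec v 0) ` ?U)"
      by (simp add: vec.linear_span_image[OF linear_extend_vec_0])
    moreover have "(\<lambda>v. extend_vec v 0) ` ?U \<subseteq> d ` S"
    proof -
      have "extend_vec (column x A) 0 \<in> d ` S" if x: "x \<in> - {e, f}" for x
      proof -
        have "extend_vec (column x A) 0 = d (Some (Some x))" using x by (simp add: col f(1))
        then show ?thesis using \<open>\<And>x. x \<noteq> e \<Longrightarrow> Some (Some x) \<in> S\<close> x by blast
      qed
      then show ?thesis by blast
    qed
    ultimately have "extend_vec (column f A) 0 \<in> vec.span (d ` S)"
      using vec.span_mono by blast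
    moreover have "d (Some (Some f)) \<in> vec.span (d ` S)"
      using that[of f] f(2) by (intro vec.span_base) auto
    ultimately have "d (Some (Some f)) - extend_vec (column f A) 0 \<in> vec.span (d ` S)"
      by (intro vec.span_diff)
    moreover have "d (Some (Some f)) - extend_vec (column f A) 0 = ?z"
      by (simp add: col f(1) vec_option_eq_iff)
    ultimately show ?thesis by simp
  qed
  have s_UNIV: "s UNIV = Suc (r UNIV)"
    using s_eq[OF z_in, of UNIV] by (simp add: merge_gamma_def)

  \<comment> \<open>The complement of j spans z, directly or by \<open>z_compl\<close>, and its
    trace misses at most one element of E; hence it has full rank, and it remains to see that j is
    not a loop.\<close>
  have one: "s UNIV + 1 \<le> s {j} + s (- {j})" for j
  proof -
    have "?z \<in> vec.span (d ` (- {j}))"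
      by (cases "j = Some None") (auto intro: z_in z_compl)
    moreover have "\<exists>x. - {x} \<subseteq> merge_gamma e (- {j})"
      by (cases "\<exists>x. j = Some (Some x)") (auto simp: merge_gamma_def)
    then have "r UNIV \<le> r (merge_gamma e (- {j}))"
      using r_compl1 mono order_trans by blast
    moreover have "1 \<le> s {j}"
    proof (cases "j = Some None")
      case True
      then show ?thesis using s_eq[OF z_in, of "{j}"] by simp
    next
      case False
      then obtain x where "{x} \<subseteq> merge_gamma e {j}"
        by (cases j) (auto simp: merge_gamma_def)
      then show ?thesis using r1[of x] mono s_ge order_trans by metis
    qed
    ultimately show ?thesis using s_UNIV s_eq by simp
  qed

  \<comment> \<open>The target is \<open>r UNIV + 3\<close>. The side \<open>- S\<close> contains z
    and so gains 1 over its trace; the other two units must come from the traces or from z being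
    spanned by \<open>S\<close> as well.\<close>
  have two: "s UNIV + 2 \<le> s S + s (- S)"
    if z: "Some None \<notin> S" and S: "2 \<le> card S" and T: "2 \<le> card (- S)" for S
  proof -
    define S0 where "S0 = {x. Some (Some x) \<in> S}"
    have subS: "S0 \<subseteq> merge_gamma e S" and subT: "- S0 \<subseteq> merge_gamma e (- S)"
      by (auto simp: S0_def merge_gamma_def)
    have sT: "s (- S) = Suc (r (merge_gamma e (- S)))"
      using z by (intro s_eq z_in) simp
    consider "2 \<le> card S0" "2 \<le> card (- S0)" | "card S0 \<le> 1" | "card (- S0) \<le> 1"
      by linarith
    then show ?thesis
    proof cases
      case 1
      then show ?thesis
        using sep[of 2 S0] mono[OF subS] mono[OF subT] s_ge[of S] sT s_UNIV by simp
    next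
      case 2
      \<comment> \<open>Having two elements, \<open>S\<close> must consist of gamma and a single x
        in E. Its rank is 2 in either case: for x = e it spans z, otherwise its trace is the pair
        {x, e}.\<close>
      have "S \<subseteq> insert None ((Some \<circ> Some) ` S0)"
        using z by (auto simp: S0_def image_iff) (metis not_Some_eq)
      moreover have "card ((Some \<circ> Some) ` S0) = card S0"
        by (intro card_image) (simp add: inj_on_def)
      ultimately have "None \<in> S" "S0 \<noteq> {}"
        using S 2 card_mono[of "(Some \<circ> Some) ` S0" S] card_mono[of "{None}" S] by auto
      then obtain x where x: "S0 = {x}"
        using 2 by (metis card_1_singletonE card_0_eq finite le_antisym less_one not_le)
      have "r UNIV \<le> r (merge_gamma e (- S))"
        using r_compl1[of x] mono[OF subT] x by simp
      moreover have "2 \<le> s S"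
      proof (cases "x = e")
        case True
        then have "?z \<in> vec.span (d ` S)"
          using \<open>None \<in> S\<close> x by (intro z_diff) (auto simp: S0_def)
        then show ?thesis using s_eq[of S] r1[of x] mono[OF subS] x by simp
      next
        case False
        have "{x, e} \<subseteq> merge_gamma e S"
          using \<open>None \<in> S\<close> x by (auto simp: S0_def merge_gamma_def)
        then show ?thesis using r2[OF False] mono s_ge[of S] order_trans by metis
      qed
      ultimately show ?thesis using sT s_UNIV by simp
    next
      case 3
      \<comment> \<open>\<open>S0\<close> may be all of E, hence an inclusion only. The trace of
        \<open>S\<close> has full rank, and two further units are needed.\<close>
      then obtain x where x: "- S0 \<subseteq> {x}"
        by (metis card_1_singletonE card_0_eq empty_subsetI finite le_antisym less_one not_le order_refl)
      then have "r UNIV \<le> r S0"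
        using r_compl1[of x] mono[of "- {x}" S0]
        by (meson Compl_subset_Compl_iff compl_le_swap2 order_trans)
      then have rS: "r UNIV \<le> r (merge_gamma e S)"
        using mono[OF subS] by simp
      show ?thesis
      proof (cases "?z \<in> vec.span (d ` S)")
        case True
        have "\<not> - S \<subseteq> {Some None}"
          using T card_mono[of "{Some None}" "- S"] by auto
        then obtain y where "{y} \<subseteq> merge_gamma e (- S)"
          by (auto simp: merge_gamma_def) (metis option.exhaust)
        then have "1 \<le> r (merge_gamma e (- S))"
          using r1[of y] mono order_trans by metis
        then show ?thesis using rS sT s_UNIV s_eq[OF True] by simp
      next
        case False
        \<comment> \<open>Since \<open>S\<close> does not span z, the missing element x differs from
          e. So e lies in \<open>S\<close>, and gamma cannot, as e - gamma = z. Thus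
          \<open>- S\<close> contains x and gamma, and e is counted in both traces.\<close>
        then have "\<not> (\<forall>y. y \<noteq> e \<longrightarrow> Some (Some y) \<in> S)"
          using z_compl by blast
        then have "x \<noteq> e" "x \<notin> S0" using x by (auto simp: S0_def)
        moreover from this have "None \<notin> S" using False z_diff x by (auto simp: S0_def)
        ultimately have "{x, e} \<subseteq> merge_gamma e (- S)"
          by (auto simp: S0_def merge_gamma_def)
        then have "2 \<le> r (merge_gamma e (- S))"
          using r2[OF \<open>x \<noteq> e\<close>] mono order_trans by metis
        then show ?thesis using rS s_ge[of S] sT s_UNIV by simp
      qed
    qed
  qed

  have "s UNIV + k \<le> s S + s (- S)"
    if "k \<in> {1, 2}" "k \<le> card S" "k \<le> card (- S)" for S k
  \<comment> \<open>If both sides have two elements, the bound for 2 covers both values of k, after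
    exchanging the sides when z lies in \<open>S\<close>. Otherwise k = 1 and one side is a
    singleton.\<close>
  proof (cases "2 \<le> card S \<and> 2 \<le> card (- S)")
    case True
    then have "s UNIV + 2 \<le> s S + s (- S)"
      using two[of S] two[of "- S"] by (cases "Some None \<in> S") (simp_all add: add.commute)
    then show ?thesis using that(1) by auto
  next
    case False
    then have "k = 1" "card S = 1 \<or> card (- S) = 1" using that by auto
    then consider j where "S = {j}" | j where "- S = {j}" by (metis card_1_singletonE)
    then show ?thesis
      using one \<open>k = 1\<close> by cases (simp, metis add.commute double_complement)
  qed
  then show ?thesis
    unfolding s_def es_splitting_def three_connected_vector_matroid_iff by blast
qed

theorem theorem3p4:
  fixes p :: nat
    and A :: "'p::prime_card mod_ring ^ 'e::finite ^ 'r::finite"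
    and M :: "'e matroid"
    and a b e :: 'e
    and \<alpha> :: "'p mod_ring"
  assumes "prime p" and "CARD('p) = p"
    and "M = vector_matroid A"
    and "simple_matroid M" and "coloopless M" and "three_connected M"
    and "card (ground M) > 4"
    and "a \<noteq> b" and "\<alpha> \<noteq> 0" and "e \<in> {a, b}"
  shows "three_connected (es_splitting A a b e \<alpha>)"
  using assms by (intro three_connected_es_splitting) simp_all

end
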